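(* For every $n\ge 1$, the set of permutations of size $n$ sortable using a pop stack with a bypass is in bijection with the set of Motzkin paths whose total number of up steps and horizontal steps is $n$, which have no peaks, and are such that every maximal sequence of (consecutive) down steps reaches the bottom level.
   Context: A pop stack with a bypass processes the entries of an input permutation $\pi=\pi_1\cdots\pi_n$ from left to right, with an initially empty stack and the following allowed operations: PUSH (insert the current input entry on top of the stack); POP (remove all elements of the stack, appending them to the right end of the output from top to bottom); BYPASS (append the current input entry directly to the right end of the output). A permutation $\pi$ of size $n$ is sortable using a pop stack with a bypass if some sequence of these operations that processes all entries and empties the stack produces the output $12\cdots n$. A Motzkin path is a lattice path starting at the origin and ending on the $x$-axis, never going below the $x$-axis, with up steps $U=(1,1)$, down steps $D=(1,-1)$ and horizontal steps $H=(1,0)$. A peak is an up step immediately followed by a down step. The bottom level is the $x$-axis; a maximal sequence of down steps reaches the bottom level if its last step ends on the $x$-axis. *)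

theory Defs
  imports
    Main
    "HOL-Library.Product_Plus"
    "HOL-Combinatorics.Multiset_Permutations"
begin

text \<open>
  A machine state is (remaining input, stack, output). The head of the input list is the
  current entry, the head of the stack list is the top of the stack, and the output is
  written from left to right.
\<close>

type_synonym pop_stack_state = "nat list \<times> nat list \<times> nat list"

inductive pop_stack_step :: "pop_stack_state \<Rightarrow> pop_stack_state \<Rightarrow> bool" where
  Push: "pop_stack_step (x # inp, stk, out) (inp, x # stk, out)"
| Pop: "pop_stack_step (inp, stk, out) (inp, [], out @ stk)"
| Bypass: "pop_stack_step (x # inp, stk, out) (inp, stk, out @ [x])"

definition sortable :: "nat list \<Rightarrow> bool" where
  "sortable \<pi> \<longleftrightarrow> pop_stack_step\<^sup>*\<^sup>* (\<pi>, [], []) ([], [], [1..<length \<pi> + 1])"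

text \<open>Permutations of size \<open>n\<close> are given in one-line notation.\<close>

definition sortable_perms :: "nat \<Rightarrow> nat list set" where
  "sortable_perms n = {\<pi> \<in> permutations_of_set {1..n}. sortable \<pi>}"

text \<open>Lattice paths start at the origin and are encoded by their sequences of steps.\<close>

datatype path_step = Up | Down | Horizontal

fun step_vec :: "path_step \<Rightarrow> int \<times> int" where
  "step_vec Up = (1, 1)"
| "step_vec Down = (1, -1)"
| "step_vec Horizontal = (1, 0)"

definition endpoint :: "path_step list \<Rightarrow> int \<times> int" where
  "endpoint p = (\<Sum>s\<leftarrow>p. step_vec s)"

definition height_at :: "path_step list \<Rightarrow> nat \<Rightarrow> int" where
  "height_at p k = snd (endpoint (take k p))"

definition motzkin_path :: "path_step list \<Rightarrow> bool" where
  "motzkin_path p \<longleftrightarrow> (\<forall>k\<le>length p. height_at p k \<ge> 0) \<and> height_at p (length p) = 0"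

definition has_peak :: "path_step list \<Rightarrow> bool" where
  "has_peak p \<longleftrightarrow> (\<exists>i. Suc i < length p \<and> p ! i = Up \<and> p ! Suc i = Down)"

text \<open>The steps with indices in \<open>{i..<j}\<close> form a (nonempty) maximal sequence of down steps.\<close>

definition maximal_down_run :: "path_step list \<Rightarrow> nat \<Rightarrow> nat \<Rightarrow> bool" where
  "maximal_down_run p i j \<longleftrightarrow>
     i < j \<and> j \<le> length p \<and> (\<forall>k\<in>{i..<j}. p ! k = Down) \<and>
     (i = 0 \<or> p ! (i - 1) \<noteq> Down) \<and> (j = length p \<or> p ! j \<noteq> Down)"

definition bypass_paths :: "nat \<Rightarrow> path_step list set" where
  "bypass_paths n = {p. motzkin_path p
     \<and> count_list p Up + count_list p Horizontal = n
     \<and> \<not> has_peak p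
     \<and> (\<forall>i j. maximal_down_run p i j \<longrightarrow> height_at p j = 0)}"

end

theory Submission
  imports Defs
begin

text \<open>
  Read an up step as a push, a horizontal step as a bypass, and a maximal run of down steps as
  a pop: as the run reaches the bottom level, popping one entry per down step empties the stack.
  A path of the required shape determines the permutation it sorts by running it backwards.
  Conversely, a sortable permutation is sorted by a path without peaks, because pushing an entry
  just before a pop may be replaced by a bypass. This path is unique: pop if the top of the stack
  is the next entry to be output, bypass if the current entry is, and push otherwise.
\<close>

section \<open>Local form of the path conditions\<close>

lemma height_at_0 [simp]: "height_at p 0 = 0"
  by (simp add: height_at_def endpoint_def)

lemma height_at_Cons_Suc [simp]:
  "height_at (s # p) (Suc k) = snd (step_vec s) + height_at p k"
  by (simp add: height_at_def endpoint_def)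

lemma has_peak_Cons_Cons [simp]:
  "has_peak (a # b # p) \<longleftrightarrow> a = Up \<and> b = Down \<or> has_peak (b # p)"
proof -
  have "(\<exists>i. P i) \<longleftrightarrow> P 0 \<or> (\<exists>i. P (Suc i))" for P :: "nat \<Rightarrow> bool"
    by (metis not0_implies_Suc)
  from this[of "\<lambda>i. Suc i < length (a # b # p) \<and> (a # b # p) ! i = Up \<and> (a # b # p) ! Suc i = Down"]
  show ?thesis by (simp add: has_peak_def)
qed

lemma not_has_peak_Nil [simp]: "\<not> has_peak []"
  and not_has_peak_single [simp]: "\<not> has_peak [a]"
  by (simp_all add: has_peak_def)

text \<open>A maximal run is determined by its last step, since extending to the left from that step
  always finds its start. So it suffices to quantify over last steps.\<close>

lemma down_runs_reach_bottom_iff: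
  "(\<forall>i j. maximal_down_run p i j \<longrightarrow> height_at p j = 0) \<longleftrightarrow>
   (\<forall>k<length p. p ! k = Down \<longrightarrow> Suc k = length p \<or> p ! Suc k \<noteq> Down \<longrightarrow>
      height_at p (Suc k) = 0)"
  (is "?L \<longleftrightarrow> ?R")
proof
  assume L: ?L
  show ?R
  proof (intro allI impI)
    fix k
    assume k: "k < length p" "p ! k = Down" "Suc k = length p \<or> p ! Suc k \<noteq> Down"
    define i where "i = (LEAST i. i \<le> k \<and> (\<forall>m\<in>{i..k}. p ! m = Down))"
    have i: "i \<le> k \<and> (\<forall>m\<in>{i..k}. p ! m = Down)"
      unfolding i_def by (rule LeastI[of _ k]) (use k in auto)
    have "i = 0 \<or> p ! (i - 1) \<noteq> Down"
    proof (rule ccontr)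
      assume neg: "\<not> (i = 0 \<or> p ! (i - 1) \<noteq> Down)"
      have "m = i - 1 \<or> m \<in> {i..k}" if "m \<in> {i - 1..k}" for m
        using that by auto
      then have "i - 1 \<le> k \<and> (\<forall>m\<in>{i - 1..k}. p ! m = Down)"
        using i neg by (metis diff_le_self le_trans)
      \<comment> \<open>Minimality of \<open>i\<close> makes the run maximal on the left.\<close>
      then have "i \<le> i - 1"
        unfolding i_def by (rule Least_le)
      with neg show False by auto
    qed
    then have "maximal_down_run p i (Suc k)"
      using i k by (auto simp: maximal_down_run_def)
    with L show "height_at p (Suc k) = 0" by blast
  qed
next
  assume R: ?R
  show ?L
  proof (intro allI impI)
    fix i j
    assume "maximal_down_run p i j"
    then show "height_at p j = 0"
      using R[rule_format, of "j - 1"] by (auto simp: maximal_down_run_def)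
  qed
qed

text \<open>The step before the suffix \<open>p\<close> is \<open>c\<close>, and the suffix starts at height \<open>h\<close>.\<close>

definition valid_suffix :: "path_step \<Rightarrow> int \<Rightarrow> path_step list \<Rightarrow> bool" where
  "valid_suffix c h p \<longleftrightarrow>
     (\<forall>k<Suc (length p). h + height_at p k \<ge> 0) \<and> h + height_at p (length p) = 0 \<and>
     \<not> has_peak (c # p) \<and>
     (\<forall>k<length p. (c # p) ! k = Down \<longrightarrow> p ! k \<noteq> Down \<longrightarrow> h + height_at p k = 0)"

lemma valid_suffix_Nil [simp]: "valid_suffix c h [] \<longleftrightarrow> h = 0"
  by (auto simp: valid_suffix_def)

text \<open>Index 0 of the conditions gives the clauses on \<open>c\<close>, \<open>s\<close> and
  \<open>h\<close>; the other indices are those of \<open>p\<close> shifted by one. So only the last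
  step and the height need to be remembered.\<close>

lemma valid_suffix_Cons [simp]:
  "valid_suffix c h (s # p) \<longleftrightarrow>
     0 \<le> h \<and> (c = Up \<longrightarrow> s \<noteq> Down) \<and> (c = Down \<longrightarrow> s \<noteq> Down \<longrightarrow> h = 0) \<and>
     valid_suffix s (h + snd (step_vec s)) p"
  unfolding valid_suffix_def length_Cons
  by (subst All_less_Suc2, subst All_less_Suc2) (auto simp: add.assoc)

text \<open>\<open>Horizontal\<close> is a neutral previous step: it neither starts a peak nor ends
  a down run. A run at the very end of the path is covered by the final height 0.\<close>

lemma bypass_paths_iff:
  "p \<in> bypass_paths n \<longleftrightarrow>
     valid_suffix Horizontal 0 p \<and> count_list p Up + count_list p Horizontal = n"
proof -
  have peak: "has_peak (Horizontal # p) = has_peak p"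
    by (cases p) auto
  have "(\<forall>k<length p. p ! k = Down \<longrightarrow> Suc k = length p \<or> p ! Suc k \<noteq> Down \<longrightarrow>
           height_at p (Suc k) = 0) \<longleftrightarrow>
        (\<forall>k<length p. (Horizontal # p) ! k = Down \<longrightarrow> p ! k \<noteq> Down \<longrightarrow> height_at p k = 0)"
    (is "?L \<longleftrightarrow> ?R") if "height_at p (length p) = 0"
  proof
    assume L: ?L
    show ?R
    proof (intro allI impI)
      fix k
      assume "k < length p" "(Horizontal # p) ! k = Down" "p ! k \<noteq> Down"
      then show "height_at p k = 0"
        using L by (cases k) auto
    qed
  next
    assume R: ?R
    show ?L
    proof (intro allI impI)
      fix k
      assume "k < length p" "p ! k = Down" "Suc k = length p \<or> p ! Suc k \<noteq> Down"
      then show "height_at p (Suc k) = 0"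
        using R[rule_format, of "Suc k"] that by (cases "Suc k = length p") auto
    qed
  qed
  then show ?thesis
    unfolding bypass_paths_def valid_suffix_def down_runs_reach_bottom_iff motzkin_path_def
    by (auto simp: less_Suc_eq_le peak)
qed

lemma valid_suffix_count:
  "valid_suffix c h p \<Longrightarrow> int (count_list p Down) = h + int (count_list p Up)"
proof (induction p arbitrary: c h)
  case (Cons s p)
  from Cons.IH[of s "h + snd (step_vec s)"] Cons.prems show ?case by (cases s) auto
qed simp

section \<open>Traces and running a path backwards\<close>

text \<open>
  Following the path \<open>p\<close>, from input \<open>inp\<close> and stack \<open>stk\<close>, outputs \<open>t\<close> and ends with empty input
  and stack; \<open>c\<close> is the step made just before. A down step pops a single entry.
\<close>

inductive trace ::
  "path_step \<Rightarrow> 'a list \<Rightarrow> 'a list \<Rightarrow> 'a list \<Rightarrow> path_step list \<Rightarrow> bool" where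
  Nil: "trace c [] [] [] []"
| Up: "(c = Down \<longrightarrow> stk = []) \<Longrightarrow> trace Up inp (x # stk) t p \<Longrightarrow>
    trace c (x # inp) stk t (Up # p)"
| Horizontal: "(c = Down \<longrightarrow> stk = []) \<Longrightarrow> trace Horizontal inp stk t p \<Longrightarrow>
    trace c (x # inp) stk (x # t) (Horizontal # p)"
| Down: "c \<noteq> Up \<Longrightarrow> trace Down inp stk t p \<Longrightarrow>
    trace c inp (x # stk) (x # t) (Down # p)"

lemma trace_valid_suffix: "trace c inp stk t p \<Longrightarrow> valid_suffix c (int (length stk)) p"
  by (induction rule: trace.induct) (auto simp: add.commute)

lemma trace_count:
  "trace c inp stk t p \<Longrightarrow> count_list p Up + count_list p Horizontal = length inp"
  by (induction rule: trace.induct) auto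

lemma trace_mset: "trace c inp stk t p \<Longrightarrow> mset t = mset inp + mset stk"
  by (induction rule: trace.induct) auto

lemma trace_set: "trace c inp stk t p \<Longrightarrow> set t = set inp \<union> set stk"
  by (induction rule: trace.induct) auto

text \<open>Backwards, \<open>Down\<close> returns an output entry to the stack,
  \<open>Horizontal\<close> returns one to the input, and \<open>Up\<close> moves the top of the
  stack to the input. The heights ensure that the stack is nonempty when \<open>Up\<close> is
  undone.\<close>

lemma trace_exists:
  assumes "valid_suffix c (int h) p" "length t = count_list p Down + count_list p Horizontal"
  shows "\<exists>inp stk. length stk = h \<and> trace c inp stk t p"
  using assms
proof (induction p arbitrary: c h t)
  case Nil
  then show ?case by (auto intro: trace.intros)
next
  case (Cons s p)
  show ?case
  proof (cases s)
    case Up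
    with Cons.prems have "valid_suffix Up (int (Suc h)) p"
      by (simp add: add.commute)
    with Cons.IH Cons.prems Up obtain inp stk
      where *: "length stk = Suc h" "trace Up inp stk t p" by fastforce
    then obtain x stk' where "stk = x # stk'" by (cases stk) auto
    with * Cons.prems Up have "length stk' = h \<and> trace c (x # inp) stk' t (s # p)"
      by (auto intro!: trace.Up)
    then show ?thesis by blast
  next
    case Horizontal
    with Cons.prems obtain x t' where t: "t = x # t'" by (cases t) auto
    with Cons.IH[of Horizontal h t'] Cons.prems Horizontal obtain inp stk
      where "length stk = h" "trace Horizontal inp stk t' p" by auto
    with Cons.prems Horizontal t have "length stk = h \<and> trace c (x # inp) stk t (s # p)"
      by (auto intro!: trace.Horizontal)
    then show ?thesis by blast
  next
    case Down
    with Cons.prems obtain x t' where t: "t = x # t'" by (cases t) auto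
    from Cons.prems Down have v: "valid_suffix Down (int h - 1) p" by simp
    \<comment> \<open>A valid suffix starts at a nonnegative height, here
      \<open>int h - 1\<close>.\<close>
    then have "h \<ge> 1" by (cases p) auto
    with v have "valid_suffix Down (int (h - 1)) p" by (simp add: of_nat_diff)
    with Cons.IH[of Down "h - 1" t'] Cons.prems Down t obtain inp stk
      where "length stk = h - 1" "trace Down inp stk t' p" by auto
    with Cons.prems Down t \<open>h \<ge> 1\<close> have "length (x # stk) = h \<and> trace c inp (x # stk) t (s # p)"
      by (auto intro!: trace.Down)
    then show ?thesis by blast
  qed
qed

text \<open>The backward run is deterministic: a step, the output and the later configuration fix
  the earlier one.\<close>

lemma trace_start_unique:
  assumes "trace c inp stk t p" "trace c' inp' stk' t p"
  shows "inp = inp' \<and> stk = stk'"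
  using assms
proof (induction arbitrary: c' inp' stk' rule: trace.induct)
  case (Nil c)
  from Nil.prems show ?case by cases simp
next
  case (Up c stk inp x t p)
  from Up.prems show ?case by cases (auto dest: Up.IH)
next
  case (Horizontal c stk inp t p x)
  from Horizontal.prems show ?case by cases (auto dest: Horizontal.IH)
next
  case (Down c inp stk t p x)
  from Down.prems show ?case by cases (auto dest: Down.IH)
qed

section \<open>Uniqueness of the sorting path\<close>

text \<open>
  An entry that is next to be output cannot lie in the stack right after a push: the next pop
  would be preceded by a push, or by a bypass that outputs another entry.
\<close>

lemma not_trace_Up_next_in_stack:
  assumes "trace c inp stk t p" "c = Up" "distinct t" "t \<noteq> []" "hd t \<in> set stk"
  shows False
  using assms
proof (induction rule: trace.induct)
  case (Horizontal c stk inp t p x)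
  then show ?case by (auto dest!: trace_set)
qed auto

lemma trace_path_unique:
  assumes "trace c inp stk t p" "trace c inp stk t q" "distinct t"
  shows "p = q"
  using assms
proof (induction arbitrary: q rule: trace.induct)
  case (Nil c)
  then show ?case by (auto elim: trace.cases)
next
  case (Up c stk inp x t p)
  \<comment> \<open>If \<open>q\<close> began with a bypass or a pop, the head of \<open>t\<close>
    would be \<open>x\<close> or the top of \<open>stk\<close>, and the push in \<open>p\<close>
    would put or leave it in the stack.\<close>
  have no_push: "t = [] \<or> hd t \<notin> set (x # stk)"
    using not_trace_Up_next_in_stack[OF Up.hyps(2)] Up.prems(2) by blast
  from Up.prems(1) show ?case
  proof cases
    case (Up p')
    with Up.IH Up.prems(2) show ?thesis by simp
  qed (use no_push in auto)
next
  case (Horizontal c stk inp t p x)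
  from Horizontal.prems(1) show ?case
  proof cases
    case (Up p')
    with not_trace_Up_next_in_stack[OF Up(3)] Horizontal.prems(2) show ?thesis by simp
  next
    case (Horizontal p')
    with Horizontal.IH Horizontal.prems(2) show ?thesis by simp
  next
    case (Down stk' p')
    \<comment> \<open>The entry \<open>x\<close> would be bypassed while also on top of the stack,
      hence output twice.\<close>
    with trace_set[OF Horizontal.hyps(2)] Horizontal.prems(2) show ?thesis by simp
  qed
next
  case (Down c inp stk t p x)
  from Down.prems(1) show ?case
  proof cases
    case (Up inp' y p')
    with not_trace_Up_next_in_stack[OF Up(4)] Down.prems(2) show ?thesis by simp
  next
    case (Horizontal inp' p')
    with trace_set[OF Down.hyps(2)] Down.prems(2) show ?thesis by simp
  next
    case (Down p')
    with Down.IH Down.prems(2) show ?thesis by simp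
  qed
qed

section \<open>Machine runs and traces\<close>

text \<open>After a down step, the rest of the stack has already been output by the pop.\<close>

lemma trace_imp_steps:
  assumes "trace c inp stk t p"
  shows "if c = Down then pop_stack_step\<^sup>*\<^sup>* (inp, [], out @ stk) ([], [], out @ t)
         else pop_stack_step\<^sup>*\<^sup>* (inp, stk, out) ([], [], out @ t)"
  using assms
proof (induction arbitrary: out rule: trace.induct)
  case (Nil c)
  then show ?case by simp
next
  case (Up c stk inp x t p)
  then show ?case
    by (auto intro: converse_rtranclp_into_rtranclp[of pop_stack_step, OF pop_stack_step.Push])
next
  case (Horizontal c stk inp t p x)
  from Horizontal.IH[of "out @ [x]"] Horizontal.hyps show ?case
    by (auto intro: converse_rtranclp_into_rtranclp[of pop_stack_step, OF pop_stack_step.Bypass])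
next
  case (Down c inp stk t p x)
  have "pop_stack_step\<^sup>*\<^sup>* (inp, [], out @ x # stk) ([], [], out @ x # t)"
    using Down.IH[of "out @ [x]"] by simp
  \<comment> \<open>Only the first down step of a run performs the machine's pop; the later ones
    need no operation.\<close>
  then show ?case
    using converse_rtranclp_into_rtranclp[of pop_stack_step, OF pop_stack_step.Pop] by simp
qed

lemma trace_weaken: "trace c inp stk t p \<Longrightarrow> trace Horizontal inp stk t p"
  by (erule trace.cases) (auto intro: trace.intros)

lemma trace_empty_stack: "trace c inp [] t p \<Longrightarrow> trace c' inp [] t p"
  by (erule trace.cases) (auto intro: trace.intros)

text \<open>A pop becomes one down step per stacked entry. The trace resumes with an empty stack,
  where the previous step imposes no constraint.\<close>

lemma trace_pop:
  assumes "trace c inp [] t p" "c' \<noteq> Up"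
  shows "trace c' inp stk (stk @ t) (replicate (length stk) Down @ p)"
  using assms(2)
  by (induction stk arbitrary: c') (auto intro: trace_empty_stack[OF assms(1)] trace.Down)

text \<open>The trace is built backwards from the final state. \<open>Horizontal\<close> is kept as
  previous step because it never restricts what follows.\<close>

lemma steps_imp_trace:
  assumes "pop_stack_step\<^sup>*\<^sup>* (inp, stk, out) ([], [], res)"
  shows "\<exists>t p. res = out @ t \<and> trace Horizontal inp stk t p"
  using assms
proof (induction "(inp, stk, out)" arbitrary: inp stk out rule: converse_rtranclp_induct)
  case base
  then show ?case by (auto intro: trace.Nil)
next
  case (step z)
  from step.hyps(1) show ?case
  proof cases
    case (Push x inp')
    with step.hyps(3) obtain t p where
      t: "res = out @ t" and tr: "trace Horizontal inp' (x # stk) t p" by blast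
    from tr show ?thesis
    proof cases
      case (Down t' p')
      \<comment> \<open>the pushed entry is popped at once, so bypass it instead\<close>
      then have "trace Horizontal inp stk (x # t') (Horizontal # p')"
        using Push by (auto intro: trace.Horizontal trace_weaken)
      with t Down show ?thesis by blast
    next
      case (Up inp'' y p')
      then have "trace Up inp' (x # stk) t p" by (auto intro: trace.Up)
      then have "trace Horizontal inp stk t (path_step.Up # p)"
        using Push by (auto intro: trace.Up)
      with t show ?thesis by blast
    next
      case (Horizontal inp'' t' p' y)
      \<comment> \<open>The path does not continue with \<open>Down\<close>, so a push may precede
        it.\<close>
      then have "trace Up inp' (x # stk) t p" by (auto intro: trace.Horizontal)
      then have "trace Horizontal inp stk t (path_step.Up # p)"
        using Push by (auto intro: trace.Up)
      with t show ?thesis by blast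
    qed
  next
    case Pop
    with step.hyps(3) obtain t p where
      "res = out @ stk @ t" "trace Horizontal inp [] t p" by fastforce
    then show ?thesis using trace_pop by blast
  next
    case (Bypass x inp')
    with step.hyps(3) obtain t p where
      "res = out @ x # t" "trace Horizontal inp' stk t p" by fastforce
    with Bypass show ?thesis by (blast intro: trace.Horizontal)
  qed
qed

lemma sortable_iff_trace:
  "sortable \<pi> \<longleftrightarrow> (\<exists>p. trace Horizontal \<pi> [] [1..<length \<pi> + 1] p)"
  unfolding sortable_def
proof
  assume "pop_stack_step\<^sup>*\<^sup>* (\<pi>, [], []) ([], [], [1..<length \<pi> + 1])"
  then show "\<exists>p. trace Horizontal \<pi> [] [1..<length \<pi> + 1] p"
    using steps_imp_trace by fastforce
next
  assume "\<exists>p. trace Horizontal \<pi> [] [1..<length \<pi> + 1] p"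
  then obtain p where "trace Horizontal \<pi> [] [1..<length \<pi> + 1] p" ..
  from trace_imp_steps[OF this, of "[]"]
  show "pop_stack_step\<^sup>*\<^sup>* (\<pi>, [], []) ([], [], [1..<length \<pi> + 1])"
    by simp
qed

theorem proposition2p2:
  fixes n :: nat
  assumes "n \<ge> 1"
  shows "\<exists>f. bij_betw f (sortable_perms n) (bypass_paths n)"
proof -
  let ?T = "\<lambda>\<pi> p. trace Horizontal \<pi> [] [1..<n + 1] p"
  have len: "length \<pi> = n" if "\<pi> \<in> sortable_perms n" for \<pi>
    using that length_finite_permutations_of_set[of \<pi> "{1..n}"] by (auto simp: sortable_perms_def)
  have ex_path: "\<exists>p. ?T \<pi> p" if "\<pi> \<in> sortable_perms n" for \<pi>
    using that len[OF that] by (auto simp: sortable_perms_def sortable_iff_trace)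
  have path: "p \<in> bypass_paths n" if "?T \<pi> p" "\<pi> \<in> sortable_perms n" for \<pi> p
    using trace_valid_suffix[OF that(1)] trace_count[OF that(1)] len[OF that(2)]
    by (simp add: bypass_paths_iff)
  have unique: "p = q" if "?T \<pi> p" "?T \<pi> q" for \<pi> p q
    using trace_path_unique[OF that] by simp
  have ex_perm: "\<exists>\<pi>\<in>sortable_perms n. ?T \<pi> p" if "p \<in> bypass_paths n" for p
  proof -
    from that have v: "valid_suffix Horizontal (int 0) p"
      and "count_list p Up + count_list p Horizontal = n" by (auto simp: bypass_paths_iff)
    \<comment> \<open>From height 0 to height 0 there are as many down steps as up steps, so the
      path outputs \<open>n\<close> entries.\<close>
    with valid_suffix_count[OF v]
    have "length [1..<n + 1] = count_list p Down + count_list p Horizontal" by simp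
    from trace_exists[OF v this] obtain \<pi> where T: "?T \<pi> p" by auto
    have m: "mset \<pi> = mset [1..<n + 1]" using trace_mset[OF T] by simp
    have "set \<pi> = {1..n}" unfolding mset_eq_setD[OF m] by auto
    moreover have "distinct \<pi>" unfolding mset_eq_imp_distinct_iff[OF m] by simp
    moreover have "length \<pi> = n" unfolding mset_eq_length[OF m] by simp
    ultimately have "\<pi> \<in> sortable_perms n"
      using T by (auto simp: sortable_perms_def sortable_iff_trace permutations_of_set_def)
    with T show ?thesis by blast
  qed
  define f where "f \<pi> = (THE p. ?T \<pi> p)" for \<pi>
  have f: "f \<pi> = p" if "?T \<pi> p" for \<pi> p
    unfolding f_def using that unique by blast
  have "bij_betw f (sortable_perms n) (bypass_paths n)"
  proof (rule bij_betwI')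
    fix \<pi> \<sigma>
    assume "\<pi> \<in> sortable_perms n" "\<sigma> \<in> sortable_perms n"
    then obtain p q where T: "?T \<pi> p" "?T \<sigma> q" using ex_path by blast
    \<comment> \<open>Injectivity: the same path and the same sorted output, run backwards, give the
      same input.\<close>
    then have "\<pi> = \<sigma>" if "p = q"
      using trace_start_unique[of Horizontal \<pi>] that by blast
    with f[OF T(1)] f[OF T(2)] show "f \<pi> = f \<sigma> \<longleftrightarrow> \<pi> = \<sigma>" by auto
  next
    fix \<pi>
    assume "\<pi> \<in> sortable_perms n"
    then show "f \<pi> \<in> bypass_paths n" using ex_path f path by blast
  next
    fix p
    assume "p \<in> bypass_paths n"
    then show "\<exists>\<pi>\<in>sortable_perms n. p = f \<pi>" using ex_perm f by metis
  qed
  then show ?thesis by blast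
qed

end
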